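(* Let $(X,d)$ be a compact metric space, let $f\colon X\to X$ be a homeomorphism, and let $\Lambda$ be a closed $f$-invariant subset of $X$. Suppose that (i) ${\rm int}[\Lambda]\ne\emptyset$; (ii) $f|_\Lambda\colon\Lambda\to\Lambda$ is chain transitive; (iii) $f$ has shadowing on $B_b(\Lambda)$ for some $b>0$. Then $\Lambda\in\mathcal{C}_{\rm ini}(f)\cap\mathcal{C}_{\rm ter}(f)$, i.e. $\Lambda$ is a chain component for $f$ that is both initial and terminal.
   Context: A subset $S\subset X$ is $f$-invariant if $f(S)\subset S$. ${\rm int}[S]$ is the interior of $S$. For $r>0$, $B_r(S)=\{x\in X: d(x,S)\le r\}$, where $d(x,S)=\inf_{y\in S}d(x,y)$. For a continuous map $f\colon X\to X$ and $\delta>0$, a $\delta$-chain of $f$ is a finite sequence $(x_i)_{i=0}^k$ in $X$, $k\ge1$, with $d(f(x_i),x_{i+1})\le\delta$ for $0\le i\le k-1$. Write $x\rightarrow y$ if for every $\delta>0$ there is a $\delta$-chain $(x_i)_{i=0}^k$ of $f$ with $x_0=x$, $x_k=y$. $f$ is chain transitive if $x\rightarrow y$ for all $x,y\in X$ (for $f|_\Lambda$ this is applied to the space $\Lambda$ with the restricted metric). The chain recurrent set is $CR(f)=\{x: x\rightarrow x\}$; on it, $x\leftrightarrow y$ iff $x\rightarrow y$ and $y\rightarrow x$ is an equivalence relation, whose equivalence classes are the chain components; $\mathcal{C}(f)$ is the set of chain components. $f$ has shadowing on $S\subset X$ if for any $\epsilon>0$ there is $\delta>0$ such that for every $\delta$-chain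 $(x_i)_{i=0}^k$ of $f$ with all $x_i\in S$ there is $x\in X$ with $\sup_{0\le i\le k}d(x_i,f^i(x))\le\epsilon$. A closed $f$-invariant set $S$ is chain stable if for any $\epsilon>0$ there is $\delta>0$ such that every $\delta$-chain $(x_i)_{i=0}^k$ of $f$ with $x_0\in S$ satisfies $d(x_k,S)\le\epsilon$. $C\in\mathcal{C}(f)$ is terminal if it is chain stable; $\mathcal{C}_{\rm ter}(f)$ is the set of terminal chain components. For a homeomorphism $f$, $C\in\mathcal{C}(f)$ is initial if $C\in\mathcal{C}_{\rm ter}(f^{-1})$; $\mathcal{C}_{\rm ini}(f)$ is the set of initial chain components. *)

theory Defs
  imports "HOL-Analysis.Analysis"
begin

text \<open>
  The metric space is a carrier set \<open>X\<close> in a type of class \<open>metric_space\<close>, with a map \<open>f\<close> of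
  which only the values on \<open>X\<close> matter. Every notion takes the carrier as an argument, so that a
  notion for a restriction of \<open>f\<close> to an invariant set \<open>S\<close> is the same notion with carrier \<open>S\<close>.
  Topological notions are relative to \<open>top_of_set X\<close>.
\<close>

definition invariant_under :: "'a set \<Rightarrow> ('a \<Rightarrow> 'a) \<Rightarrow> 'a set \<Rightarrow> bool" where
  "invariant_under X f S \<longleftrightarrow> S \<subseteq> X \<and> f ` S \<subseteq> S"

text \<open>
  \<open>infdist x {} = 0\<close> by convention, so the neighbourhood is meaningful for \<open>S \<noteq> {}\<close> only.
\<close>

definition closed_nbhd :: "'a::metric_space set \<Rightarrow> real \<Rightarrow> 'a set \<Rightarrow> 'a set" where
  "closed_nbhd X r S = {x \<in> X. infdist x S \<le> r}"

text \<open>The chain consists of \<open>x 0, \<dots>, x k\<close>; later values of \<open>x\<close> are irrelevant.\<close>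

definition delta_chain ::
  "'a::metric_space set \<Rightarrow> ('a \<Rightarrow> 'a) \<Rightarrow> real \<Rightarrow> nat \<Rightarrow> (nat \<Rightarrow> 'a) \<Rightarrow> bool" where
  "delta_chain X f \<delta> k x \<longleftrightarrow>
     1 \<le> k \<and> (\<forall>i\<le>k. x i \<in> X) \<and> (\<forall>i<k. dist (f (x i)) (x (Suc i)) \<le> \<delta>)"

definition chain_to :: "'a::metric_space set \<Rightarrow> ('a \<Rightarrow> 'a) \<Rightarrow> 'a \<Rightarrow> 'a \<Rightarrow> bool" where
  "chain_to X f x y \<longleftrightarrow> (\<forall>\<delta>>0. \<exists>k c. delta_chain X f \<delta> k c \<and> c 0 = x \<and> c k = y)"

definition chain_transitive :: "'a::metric_space set \<Rightarrow> ('a \<Rightarrow> 'a) \<Rightarrow> bool" where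
  "chain_transitive X f \<longleftrightarrow> (\<forall>x\<in>X. \<forall>y\<in>X. chain_to X f x y)"

definition chain_recurrent_set :: "'a::metric_space set \<Rightarrow> ('a \<Rightarrow> 'a) \<Rightarrow> 'a set" where
  "chain_recurrent_set X f = {x \<in> X. chain_to X f x x}"

definition chain_equiv :: "'a::metric_space set \<Rightarrow> ('a \<Rightarrow> 'a) \<Rightarrow> ('a \<times> 'a) set" where
  "chain_equiv X f = {(x, y). x \<in> chain_recurrent_set X f \<and> y \<in> chain_recurrent_set X f \<and>
                              chain_to X f x y \<and> chain_to X f y x}"

definition chain_components :: "'a::metric_space set \<Rightarrow> ('a \<Rightarrow> 'a) \<Rightarrow> 'a set set" where
  "chain_components X f = chain_recurrent_set X f // chain_equiv X f"

text \<open>The shadowing point lies in \<open>X\<close>, not necessarily in \<open>S\<close>.\<close>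

definition shadowing_on :: "'a::metric_space set \<Rightarrow> ('a \<Rightarrow> 'a) \<Rightarrow> 'a set \<Rightarrow> bool" where
  "shadowing_on X f S \<longleftrightarrow>
     (\<forall>\<epsilon>>0. \<exists>\<delta>>0. \<forall>k x. delta_chain X f \<delta> k x \<and> (\<forall>i\<le>k. x i \<in> S) \<longrightarrow>
        (\<exists>z\<in>X. \<forall>i\<le>k. dist (x i) ((f ^^ i) z) \<le> \<epsilon>))"

definition chain_stable :: "'a::metric_space set \<Rightarrow> ('a \<Rightarrow> 'a) \<Rightarrow> 'a set \<Rightarrow> bool" where
  "chain_stable X f S \<longleftrightarrow>
     closedin (top_of_set X) S \<and> invariant_under X f S \<and>
     (\<forall>\<epsilon>>0. \<exists>\<delta>>0. \<forall>k x. delta_chain X f \<delta> k x \<and> x 0 \<in> S \<longrightarrow> infdist (x k) S \<le> \<epsilon>)"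

definition terminal_chain_components ::
  "'a::metric_space set \<Rightarrow> ('a \<Rightarrow> 'a) \<Rightarrow> 'a set set" where
  "terminal_chain_components X f = {C \<in> chain_components X f. chain_stable X f C}"

text \<open>Intended for \<open>f\<close> a homeomorphism of \<open>X\<close>, whose inverse on \<open>X\<close> is \<open>inv_into X f\<close>.\<close>

definition initial_chain_components ::
  "'a::metric_space set \<Rightarrow> ('a \<Rightarrow> 'a) \<Rightarrow> 'a set set" where
  "initial_chain_components X f =
     {C \<in> chain_components X f. C \<in> terminal_chain_components X (inv_into X f)}"

end

theory Submission
  imports Defs
begin

text \<open>
  Let \<open>p\<close> be an interior point of \<open>\<Lambda>\<close>. A chain that starts in \<open>\<Lambda>\<close> can be preceded by a chain in
  \<open>\<Lambda>\<close> from \<open>p\<close>. As long as it stays in \<open>B\<^sub>b(\<Lambda>)\<close>, the result is shadowed by the orbit of a point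
  close to \<open>p\<close>, which lies in \<open>\<Lambda>\<close>; so the chain stays close to \<open>\<Lambda>\<close>, and in particular never leaves
  \<open>B\<^sub>b(\<Lambda>)\<close>. Hence \<open>\<Lambda>\<close> is chain stable. The hypotheses pass from \<open>f\<close> to its inverse by reversing
  chains, so \<open>\<Lambda>\<close> is chain stable for the inverse as well.
\<close>

lemma delta_chain_mono:
  assumes "delta_chain S f \<delta> k c" "S \<subseteq> X" "\<delta> \<le> \<epsilon>"
  shows "delta_chain X f \<epsilon> k c"
  using assms unfolding delta_chain_def by fastforce

text \<open>The common point \<open>c k = x 0\<close> is listed once, as the start of
  \<open>x\<close>, so the lengths add up to exactly \<open>k + m\<close>.\<close>

lemma delta_chain_append:
  assumes c: "delta_chain X f \<delta> k c" and x: "delta_chain X f \<delta> m x" and eq: "c k = x 0"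
  shows "delta_chain X f \<delta> (k + m) (\<lambda>i. if i < k then c i else x (i - k))"
  unfolding delta_chain_def
proof (intro conjI allI impI)
  show "1 \<le> k + m" using c by (simp add: delta_chain_def)
  show "(if i < k then c i else x (i - k)) \<in> X" if "i \<le> k + m" for i
    using that c x by (auto simp: delta_chain_def)
  fix i assume i: "i < k + m"
  consider "Suc i < k" | "Suc i = k" | "k \<le> i" by linarith
  then show "dist (f (if i < k then c i else x (i - k)))
    (if Suc i < k then c (Suc i) else x (Suc i - k)) \<le> \<delta>"
  proof cases
    case 1
    then show ?thesis using c by (simp add: delta_chain_def)
  next
    case 2
    then have "dist (f (c i)) (c k) \<le> \<delta>" using c by (auto simp: delta_chain_def)
    with 2 eq show ?thesis by auto
  next
    case 3
    then have "i - k < m" using i by linarith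
    then have "dist (f (x (i - k))) (x (Suc (i - k))) \<le> \<delta>"
      using x by (simp add: delta_chain_def)
    with 3 show ?thesis by (simp add: Suc_diff_le)
  qed
qed

text \<open>The infimum need not be attained, hence the strictly larger bound
  \<open>s\<close>.\<close>

lemma infdist_leE:
  assumes "infdist x S \<le> r" "r < s" "S \<noteq> {}"
  obtains y where "y \<in> S" "dist x y < s"
proof -
  have "Inf ((\<lambda>y. dist x y) ` S) < s"
    using assms by (simp add: infdist_notempty)
  then show ?thesis
    using cInf_lessD[of "(\<lambda>y. dist x y) ` S" s] assms(3) that by blast
qed

lemma interior_of_ball:
  assumes "(top_of_set X) interior_of S \<noteq> {}"
  obtains p r where "p \<in> S" "r > 0" "\<And>z. z \<in> X \<Longrightarrow> dist p z < r \<Longrightarrow> z \<in> S"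
proof -
  from assms obtain p where p: "p \<in> (top_of_set X) interior_of S" by blast
  then obtain U where U: "openin (top_of_set X) U" "p \<in> U" "U \<subseteq> S"
    by (auto simp: interior_of_def)
  then obtain r where "r > 0" "\<forall>z\<in>X. dist z p < r \<longrightarrow> z \<in> U"
    unfolding openin_euclidean_subtopology_iff by blast
  with U that[of p r] show ?thesis by (auto simp: dist_commute)
qed

lemma funpow_image_subset:
  assumes "f ` S \<subseteq> S" "z \<in> S"
  shows "(f ^^ n) z \<in> S"
  using assms by (induction n) auto

text \<open>A point near \<open>S\<close> has a neighbour in \<open>S\<close>; uniform continuity
  keeps their images close, and the image of the neighbour stays in \<open>S\<close>. This controls
  how far one step of a chain can move away from \<open>S\<close>.\<close>

lemma invariant_infdist_bound:
  assumes "compact X" "continuous_on X f" "S \<subseteq> X" "f ` S \<subseteq> S" "S \<noteq> {}" "\<epsilon> > 0"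
  obtains \<eta> where "\<eta> > 0" "\<And>x. x \<in> X \<Longrightarrow> infdist x S \<le> \<eta> \<Longrightarrow> infdist (f x) S \<le> \<epsilon>"
proof -
  have "uniformly_continuous_on X f"
    using assms by (simp add: compact_uniformly_continuous)
  then obtain d where d: "d > 0" "\<And>x y. x \<in> X \<Longrightarrow> y \<in> X \<Longrightarrow> dist x y < d \<Longrightarrow> dist (f x) (f y) < \<epsilon>"
    using \<open>\<epsilon> > 0\<close> unfolding uniformly_continuous_on_def by (metis dist_commute)
  have "infdist (f x) S \<le> \<epsilon>" if x: "x \<in> X" "infdist x S \<le> d / 2" for x
  proof -
    obtain y where y: "y \<in> S" "dist x y < d"
      using infdist_leE[OF x(2) _ \<open>S \<noteq> {}\<close>, of d] d(1) by auto
    then have "dist (f x) (f y) < \<epsilon>" using d x assms(3) by blast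
    moreover have "infdist (f x) S \<le> dist (f x) (f y)"
      using y assms(4) by (intro infdist_le) auto
    ultimately show ?thesis by linarith
  qed
  with d(1) that[of "d / 2"] show ?thesis by simp
qed

text \<open>Shadowing applies only to chains inside the neighbourhood, which is what has to be
  controlled. Induction along the chain breaks the circle: closeness up to \<open>x j\<close> gives
  the crude bound \<open>b\<close> for the next point, and shadowing then improves \<open>b\<close>
  to \<open>e\<close>.\<close>

lemma chain_stable_if_shadowing:
  assumes X: "compact X" "continuous_on X f"
    and L: "closedin (top_of_set X) L" "invariant_under X f L"
    and int: "(top_of_set X) interior_of L \<noteq> {}"
    and trans: "chain_transitive L f"
    and b: "b > 0" and shad: "shadowing_on X f (closed_nbhd X b L)"
  shows "chain_stable X f L"
proof -
  have LX: "L \<subseteq> X" and fL: "f ` L \<subseteq> L" using L by (auto simp: invariant_under_def)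
  obtain p r where p: "p \<in> L" and r: "r > 0" "\<And>z. z \<in> X \<Longrightarrow> dist p z < r \<Longrightarrow> z \<in> L"
    using interior_of_ball[OF int] by blast
  have ne: "L \<noteq> {}" using p by blast
  obtain \<eta> where eta: "\<eta> > 0" "\<And>x. x \<in> X \<Longrightarrow> infdist x L \<le> \<eta> \<Longrightarrow> infdist (f x) L \<le> b / 2"
    using invariant_infdist_bound[OF X LX fL ne, of "b / 2"] b by auto
  have "\<exists>\<delta>>0. \<forall>k x. delta_chain X f \<delta> k x \<and> x 0 \<in> L \<longrightarrow> infdist (x k) L \<le> \<epsilon>"
    if "\<epsilon> > 0" for \<epsilon>
  proof -
    \<comment> \<open>\<open>\<epsilon>\<close> is the goal, \<open>\<eta>\<close> gives the
      one-step estimate, \<open>b\<close> keeps earlier points in the neighbourhood, and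
      \<open>r / 2\<close> puts the shadowing point strictly inside the ball around
      \<open>p\<close>.\<close>
    define e where "e = Min {\<epsilon>, \<eta>, b, r / 2}"
    have e: "e > 0" "e \<le> \<epsilon>" "e \<le> \<eta>" "e \<le> b" "e < r"
      using \<open>\<epsilon> > 0\<close> eta(1) b r(1) by (auto simp: e_def min_def)
    obtain d where d: "d > 0"
      "\<And>k x. delta_chain X f d k x \<Longrightarrow> (\<forall>i\<le>k. x i \<in> closed_nbhd X b L) \<Longrightarrow>
        \<exists>z\<in>X. \<forall>i\<le>k. dist (x i) ((f ^^ i) z) \<le> e"
      using shad e(1) unfolding shadowing_on_def by meson
    \<comment> \<open>\<open>d\<close> is for shadowing; the jump of at most \<open>b / 2\<close>
      and the bound \<open>b / 2\<close> for \<open>f (x j)\<close> add up to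
      \<open>b\<close>.\<close>
    define \<delta> where "\<delta> = min d (b / 2)"
    have \<delta>: "\<delta> > 0" "\<delta> \<le> d" "\<delta> \<le> b / 2" using d b by (auto simp: \<delta>_def)
    have "infdist (x k) L \<le> e" if ch: "delta_chain X f \<delta> k x" and x0: "x 0 \<in> L" for k x
    proof -
      \<comment> \<open>The induction is strong because shadowing requires the whole segment up to
        \<open>i\<close> to lie in the neighbourhood.\<close>
      have "i \<le> k \<longrightarrow> infdist (x i) L \<le> e" for i
      proof (induction i rule: less_induct)
        case (less i)
        show ?case
        proof
          assume ik: "i \<le> k"
          show "infdist (x i) L \<le> e"
          proof (cases i)
            case 0
            then show ?thesis using x0 e(1) by simp
          next
            case (Suc j)
            have chi: "delta_chain X f d i x"
            proof (rule delta_chain_mono[OF _ order_refl \<delta>(2)])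
              show "delta_chain X f \<delta> i x" using ch ik Suc by (auto simp: delta_chain_def)
            qed
            have "infdist (f (x j)) L \<le> b / 2"
              using eta(2)[of "x j"] less[of j] Suc ik e ch by (auto simp: delta_chain_def)
            moreover have "dist (f (x j)) (x i) \<le> \<delta>"
              using ch ik Suc by (simp add: delta_chain_def)
            moreover have "infdist (x i) L \<le> infdist (f (x j)) L + dist (x i) (f (x j))"
              by (rule infdist_triangle)
            ultimately have "infdist (x i) L \<le> b"
              using \<delta>(3) by (simp add: dist_commute)
            then have xb: "x l \<in> closed_nbhd X b L" if "l \<le> i" for l
              using that less[of l] ik e ch
              by (cases "l = i") (auto simp: closed_nbhd_def delta_chain_def)
            \<comment> \<open>The length \<open>m\<close> depends on the chain, but \<open>d\<close>
              and \<open>e\<close> do not depend on length.\<close>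
            obtain m c where c: "delta_chain L f d m c" "c 0 = p" "c m = x 0"
              using trans p x0 d(1) unfolding chain_transitive_def chain_to_def by meson
            let ?y = "\<lambda>l. if l < m then c l else x (l - m)"
            have "delta_chain X f d (m + i) ?y"
              using delta_chain_append[OF delta_chain_mono[OF c(1) LX] chi] c by simp
            moreover have "\<forall>l\<le>m + i. ?y l \<in> closed_nbhd X b L"
            proof (intro allI impI)
              fix l assume l: "l \<le> m + i"
              have "c l \<in> L" if "l < m" using c(1) that by (simp add: delta_chain_def)
              then have "c l \<in> closed_nbhd X b L" if "l < m"
                using that b LX by (auto simp: closed_nbhd_def)
              then show "?y l \<in> closed_nbhd X b L" using xb[of "l - m"] l by auto
            qed
            ultimately obtain z where z: "z \<in> X" "\<forall>l\<le>m + i. dist (?y l) ((f ^^ l) z) \<le> e"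
              using d(2) by blast
            have "m \<ge> 1" using c(1) by (simp add: delta_chain_def)
            then have "dist p z \<le> e" using z(2)[rule_format, of 0] c(2) by auto
            \<comment> \<open>Here the interior point enters: a shadowing point known only to be in
              \<open>X\<close> lands in \<open>L\<close>, and invariance keeps its orbit
              there.\<close>
            then have "z \<in> L" using r(2) z(1) e by auto
            then have "(f ^^ (m + i)) z \<in> L" by (rule funpow_image_subset[OF fL])
            then have "infdist (x i) L \<le> dist (x i) ((f ^^ (m + i)) z)" by (rule infdist_le)
            also have "\<dots> \<le> e" using z(2)[rule_format, of "m + i"] by simp
            finally show ?thesis .
          qed
        qed
      qed
      then show ?thesis by simp
    qed
    with \<delta>(1) e(2) show ?thesis by (meson order_trans)
  qed
  with L show ?thesis by (simp add: chain_stable_def)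
qed

text \<open>Transitivity puts \<open>L\<close> inside the class of \<open>p\<close>. Conversely,
  stability for every \<open>\<epsilon>\<close> forces anything reachable from \<open>p\<close> to
  have distance 0 from the closed set \<open>L\<close>.\<close>

lemma chain_component_if_chain_stable:
  assumes stable: "chain_stable X f L" and trans: "chain_transitive L f" and p: "p \<in> L"
  shows "L \<in> chain_components X f"
proof -
  have LX: "L \<subseteq> X" using stable by (simp add: chain_stable_def invariant_under_def)
  have to: "chain_to X f x y" if "x \<in> L" "y \<in> L" for x y
    using trans that delta_chain_mono[OF _ LX order_refl]
    unfolding chain_transitive_def chain_to_def by meson
  then have CR: "L \<subseteq> chain_recurrent_set X f" using LX by (auto simp: chain_recurrent_set_def)
  have "y \<in> L" if y: "y \<in> X" "chain_to X f p y" for y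
  proof -
    have "infdist y L \<le> \<epsilon>" if "\<epsilon> > 0" for \<epsilon>
      using stable y(2) p that unfolding chain_stable_def chain_to_def by metis
    then have "infdist y L \<le> 0" by (rule field_le_epsilon) simp
    then have "infdist y L = 0" using infdist_nonneg[of y L] by linarith
    moreover have "L \<noteq> {}" using p by blast
    ultimately have "y \<in> closure L" by (simp add: in_closure_iff_infdist_zero)
    \<comment> \<open>\<open>L\<close> is closed relative to \<open>X\<close>, hence the
      intersection.\<close>
    moreover have "X \<inter> closure L \<subseteq> L"
      using stable unfolding chain_stable_def closedin_closed
      by (metis Int_lower2 closure_minimal inf_mono order_refl)
    ultimately show ?thesis using y(1) by blast
  qed
  then have "chain_equiv X f `` {p} = L"
    using to CR p by (auto simp: chain_equiv_def chain_recurrent_set_def)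
  then show ?thesis
    using CR p unfolding chain_components_def by (metis quotientI subsetD)
qed

text \<open>A missed point would have positive distance from the compact image, so chains with
  smaller jumps could not end there. This upgrades forward invariance of \<open>\<Lambda>\<close> to
  invariance under the inverse.\<close>

lemma chain_transitive_image:
  assumes "compact S" "continuous_on S f" "f ` S \<subseteq> S" "chain_transitive S f"
  shows "f ` S = S"
proof (rule ccontr)
  assume "f ` S \<noteq> S"
  then obtain y where y: "y \<in> S" "y \<notin> f ` S" using assms(3) by blast
  have "closed (f ` S)"
    using assms by (simp add: compact_continuous_image compact_imp_closed)
  then obtain e where e: "e > 0" "\<forall>x. dist x y < e \<longrightarrow> x \<notin> f ` S"
    using y(2) by (metis ComplD ComplI closed_def open_dist)
  have "chain_to S f y y" using assms(4) y(1) by (simp add: chain_transitive_def)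
  then obtain k c where c: "delta_chain S f (e / 2) k c" "c k = y"
    using e(1) unfolding chain_to_def by (meson half_gt_zero)
  then obtain j where j: "k = Suc j" by (cases k) (auto simp: delta_chain_def)
  with c have "dist (f (c j)) y \<le> e / 2" "c j \<in> S" by (auto simp: delta_chain_def)
  moreover have "e / 2 < e" using e(1) by simp
  ultimately show False using e(2) by (meson imageI le_less_trans)
qed

text \<open>If \<open>g (x j)\<close> is close to \<open>x (Suc j)\<close>, applying the uniformly
  continuous \<open>f\<close> makes \<open>x j\<close> close to
  \<open>f (x (Suc j))\<close>.\<close>

lemma delta_chain_reverse:
  assumes "compact X" "homeomorphism X X f g" "\<epsilon> > 0"
  obtains \<delta> where "\<delta> > 0"
    "\<And>k x. delta_chain X g \<delta> k x \<Longrightarrow> delta_chain X f \<epsilon> k (\<lambda>i. x (k - i))"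
proof -
  have "uniformly_continuous_on X f"
    using assms by (simp add: compact_uniformly_continuous homeomorphism_def)
  then obtain d where d: "d > 0" "\<And>x y. x \<in> X \<Longrightarrow> y \<in> X \<Longrightarrow> dist x y < d \<Longrightarrow> dist (f x) (f y) < \<epsilon>"
    using \<open>\<epsilon> > 0\<close> unfolding uniformly_continuous_on_def by (metis dist_commute)
  have "delta_chain X f \<epsilon> k (\<lambda>i. x (k - i))" if ch: "delta_chain X g (d / 2) k x" for k x
    unfolding delta_chain_def
  proof (intro conjI allI impI)
    show "1 \<le> k" "x (k - i) \<in> X" for i using ch by (auto simp: delta_chain_def)
    fix i assume i: "i < k"
    define j where "j = k - Suc i"
    have j: "k - i = Suc j" "j < k" using i by (auto simp: j_def)
    have X: "x j \<in> X" "x (Suc j) \<in> X" using ch j by (auto simp: delta_chain_def)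
    then have gX: "g (x j) \<in> X" using assms(2) by (auto simp: homeomorphism_def)
    have "dist (g (x j)) (x (Suc j)) \<le> d / 2" using ch j by (auto simp: delta_chain_def)
    then have "dist (x (Suc j)) (g (x j)) < d" using d(1) by (simp add: dist_commute)
    then have "dist (f (x (Suc j))) (f (g (x j))) < \<epsilon>" using d(2) X gX by blast
    then show "dist (f (x (k - i))) (x (k - Suc i)) \<le> \<epsilon>"
      using X assms(2) j by (auto simp: homeomorphism_def j_def)
  qed
  with d(1) that[of "d / 2"] show ?thesis by simp
qed

lemma chain_transitive_inverse:
  assumes "compact S" "homeomorphism S S f g" "chain_transitive S f"
  shows "chain_transitive S g"
  unfolding chain_transitive_def chain_to_def
proof (intro ballI allI impI)
  fix x y and \<epsilon> :: real assume xy: "x \<in> S" "y \<in> S" and "\<epsilon> > 0"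
  obtain \<delta> where \<delta>: "\<delta> > 0"
    "\<And>k c. delta_chain S f \<delta> k c \<Longrightarrow> delta_chain S g \<epsilon> k (\<lambda>i. c (k - i))"
    \<comment> \<open>The roles of \<open>f\<close> and \<open>g\<close> are swapped, so that chains
      of \<open>f\<close> become chains of \<open>g\<close>.\<close>
    using delta_chain_reverse[OF assms(1) homeomorphism_symD[OF assms(2)] \<open>\<epsilon> > 0\<close>] by blast
  obtain k c where c: "delta_chain S f \<delta> k c" "c 0 = y" "c k = x"
    using assms(3) xy \<delta>(1) unfolding chain_transitive_def chain_to_def by meson
  then have "delta_chain S g \<epsilon> k (\<lambda>i. c (k - i)) \<and> c (k - 0) = x \<and> c (k - k) = y"
    using \<delta>(2) by simp
  then show "\<exists>k c. delta_chain S g \<epsilon> k c \<and> c 0 = x \<and> c k = y" by blast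
qed

lemma funpow_inverse:
  assumes "homeomorphism X X f g" "z \<in> X" "i \<le> k"
  shows "(g ^^ i) ((f ^^ k) z) = (f ^^ (k - i)) z"
  using assms(3)
proof (induction i)
  case (Suc i)
  then have "k - i = Suc (k - Suc i)" by simp
  moreover have "(f ^^ (k - Suc i)) z \<in> X"
    using assms by (intro funpow_image_subset) (auto simp: homeomorphism_def)
  ultimately show ?case using Suc assms(1) by (simp add: homeomorphism_def)
qed simp

text \<open>If \<open>z\<close> shadows the reversed chain under \<open>f\<close>, then the end
  \<open>(f ^^ k) z\<close> of its orbit segment shadows the original chain under
  \<open>g\<close>.\<close>

lemma shadowing_on_inverse:
  assumes "compact X" "homeomorphism X X f g" "shadowing_on X f S"
  shows "shadowing_on X g S"
  unfolding shadowing_on_def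
proof (intro allI impI)
  fix \<epsilon> :: real assume "\<epsilon> > 0"
  then obtain d where d: "d > 0"
    "\<And>k x. delta_chain X f d k x \<Longrightarrow> (\<forall>i\<le>k. x i \<in> S) \<Longrightarrow>
      \<exists>z\<in>X. \<forall>i\<le>k. dist (x i) ((f ^^ i) z) \<le> \<epsilon>"
    using assms(3) unfolding shadowing_on_def by meson
  obtain \<delta> where \<delta>: "\<delta> > 0"
    "\<And>k x. delta_chain X g \<delta> k x \<Longrightarrow> delta_chain X f d k (\<lambda>i. x (k - i))"
    using delta_chain_reverse[OF assms(1,2) d(1)] by blast
  have "\<exists>w\<in>X. \<forall>i\<le>k. dist (x i) ((g ^^ i) w) \<le> \<epsilon>"
    if x: "delta_chain X g \<delta> k x" "\<forall>i\<le>k. x i \<in> S" for k x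
  proof -
    obtain z where z: "z \<in> X" "\<forall>i\<le>k. dist (x (k - i)) ((f ^^ i) z) \<le> \<epsilon>"
      using d(2)[OF \<delta>(2)[OF x(1)]] x(2) by auto
    have "dist (x i) ((g ^^ i) ((f ^^ k) z)) \<le> \<epsilon>" if "i \<le> k" for i
      using z(2)[rule_format, of "k - i"] that funpow_inverse[OF assms(2) z(1) that] by simp
    moreover have "(f ^^ k) z \<in> X"
      using assms(2) z(1) by (intro funpow_image_subset) (auto simp: homeomorphism_def)
    ultimately show ?thesis by blast
  qed
  with \<delta>(1) show "\<exists>\<delta>>0. \<forall>k x. delta_chain X g \<delta> k x \<and> (\<forall>i\<le>k. x i \<in> S) \<longrightarrow>
      (\<exists>z\<in>X. \<forall>i\<le>k. dist (x i) ((g ^^ i) z) \<le> \<epsilon>)"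
    by blast
qed

theorem lemma4p3:
  fixes X \<Lambda> :: "'a::metric_space set" and f :: "'a \<Rightarrow> 'a" and b :: real
  assumes "compact X"
    and "\<exists>g. homeomorphism X X f g"
    and "closedin (top_of_set X) \<Lambda>"
    and "invariant_under X f \<Lambda>"
    and "(top_of_set X) interior_of \<Lambda> \<noteq> {}"
    and "chain_transitive \<Lambda> f"
    and "b > 0"
    and "shadowing_on X f (closed_nbhd X b \<Lambda>)"
  shows "\<Lambda> \<in> initial_chain_components X f \<inter> terminal_chain_components X f"
proof -
  let ?g = "inv_into X f"
  obtain h where h: "homeomorphism X X f h" using assms(2) by blast
  then have "inj_on f X" by (auto simp: homeomorphism_def inj_on_def) metis
  \<comment> \<open>The definition of initial components uses \<open>inv_into\<close>, so the given
    inverse \<open>h\<close> is replaced by it on \<open>X\<close>.\<close>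
  then have "?g y = h y" if "y \<in> X" for y
    using h that by (intro inv_into_f_eq) (auto simp: homeomorphism_def)
  then have hom: "homeomorphism X X f ?g"
    using homeomorphism_cong[OF h] by simp
  have \<Lambda>X: "\<Lambda> \<subseteq> X" and f\<Lambda>: "f ` \<Lambda> \<subseteq> \<Lambda>" using assms(4) by (auto simp: invariant_under_def)
  have cont: "continuous_on X f" "continuous_on X ?g" using hom by (auto simp: homeomorphism_def)
  have comp: "compact \<Lambda>" using assms(1,3) by (rule closedin_compact)
  have "f ` \<Lambda> = \<Lambda>"
    using chain_transitive_image[OF comp continuous_on_subset[OF cont(1) \<Lambda>X] f\<Lambda> assms(6)] .
  then have hom\<Lambda>: "homeomorphism \<Lambda> \<Lambda> f ?g"
    using homeomorphism_of_subsets[OF hom \<Lambda>X \<Lambda>X] by blast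
  then have inv: "invariant_under X ?g \<Lambda>"
    using \<Lambda>X by (auto simp: invariant_under_def homeomorphism_def)
  have trans: "chain_transitive \<Lambda> ?g" by (rule chain_transitive_inverse[OF comp hom\<Lambda> assms(6)])
  have stable: "chain_stable X f \<Lambda>"
    by (rule chain_stable_if_shadowing[OF assms(1) cont(1) assms(3-8)])
  have stable_inv: "chain_stable X ?g \<Lambda>"
    by (rule chain_stable_if_shadowing[OF assms(1) cont(2) assms(3) inv assms(5) trans assms(7)
          shadowing_on_inverse[OF assms(1) hom assms(8)]])
  obtain p where "p \<in> \<Lambda>" using interior_of_ball[OF assms(5)] by blast
  \<comment> \<open>Being initial asks for a chain component of both \<open>f\<close> and its
    inverse, so the component lemma is applied to each map.\<close>
  then show ?thesis
    using chain_component_if_chain_stable[OF stable assms(6)]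
      chain_component_if_chain_stable[OF stable_inv trans] stable stable_inv
    by (simp add: initial_chain_components_def terminal_chain_components_def)
qed

end
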